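(* For every integer $n\ge 2$ and $t\in(0,1)$, let $s(t,n)$ be the ratio defined in the context. The following statements are true: (i) For each $n\ge 2$, the function $t\mapsto s(t,n)$ is strictly decreasing over $(0,1)$. (ii) For each $n\ge 2$, $\lim_{t\to 0} s(t,n)=\infty$. (iii) Let $g(n):=\lim_{t\to 1} s(t,n)$. Then $g(n)\in[3/2,\,e-1)$ for any $n\ge 2$. Furthermore, $g(n)$ is strictly increasing in $n\ge 2$ and satisfies $g(2)=3/2$ and $\lim_{n\to\infty} g(n)=e-1$.
   Context: Let $n\ge 2$ be an integer, $t\in(0,1)$, and $\alpha=t/(n-1)\in(0,1/(n-1))$. Let $\mathbf{1}\in\mathbb{R}^n$ be the all-ones vector and $A=(1+\alpha)I-\alpha\mathbf{1}\mathbf{1}^T\in\mathbb{R}^{n\times n}$ (so $A$ has unit diagonal and all off-diagonal entries equal to $-\alpha$). Write $A=I-N-N^T$, where $-N$ is the strictly lower triangular part of $A$. Define - $B_{\mathrm{CCD}}=(I-N)^{-1}N^T$, the iteration matrix of one epoch of cyclic coordinate descent with exact line search on $f(x)=\frac12x^TAx$; - $B_{\mathrm{RPCD}}=\mathbb{E}_P[P B_{\mathrm{CCD}}P^T]$, where $P$ is a uniformly random $n\times n$ permutation matrix (the expected one-epoch iteration matrix of random-permutations cyclic coordinate descent; here $P^TAP=A$ for every permutation matrix $P$); - $B_{\mathrm{RCD}}=I-\frac1n A$ (the expected one-iteration matrix of coordinate descent with coordinates sampled uniformly with replacement). Let $\rho(\cdot)$ denote the spectral radius and $\log$ the natural logarithm.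 Define $$s(t,n)=\frac{-\log\rho(B_{\mathrm{RPCD}})}{-\log\big(\rho(B_{\mathrm{RCD}})^n\big)}.$$ The limits $t\to0$ and $t\to1$ are taken within $t\in(0,1)$. *)

theory Defs
  imports "HOL-Probability.Probability_Mass_Function" "Jordan_Normal_Form.Spectral_Radius"
    "Jordan_Normal_Form.Gauss_Jordan_Elimination"
begin

text \<open>
  All matrices are of type \<^typ>\<open>real Matrix.mat\<close>, with row and column indices ranging
  over \<open>{0..<n}\<close>; the constant matrix \<open>Matrix.mat n n (\<lambda>(i, j). 1)\<close> below is the outer
  product of the all-ones vector with itself.
\<close>

definition A_mat :: "nat \<Rightarrow> real \<Rightarrow> real Matrix.mat" where
  "A_mat n t =
     (let \<alpha> = t / (real n - 1)
      in (1 + \<alpha>) \<cdot>\<^sub>m 1\<^sub>m n - \<alpha> \<cdot>\<^sub>m Matrix.mat n n (\<lambda>(i, j). 1))"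

text \<open>The negative of the strictly lower triangular part.\<close>

definition N_mat :: "real Matrix.mat \<Rightarrow> real Matrix.mat" where
  "N_mat A = Matrix.mat (dim_row A) (dim_col A) (\<lambda>(i, j). if j < i then - (A $$ (i, j)) else 0)"

text \<open>
  \<^const>\<open>mat_inverse\<close> is \<^const>\<open>None\<close> only on singular matrices; here it is applied to a
  lower triangular matrix with unit diagonal.
\<close>

definition B_CCD :: "real Matrix.mat \<Rightarrow> real Matrix.mat" where
  "B_CCD A = the (mat_inverse (1\<^sub>m (dim_row A) - N_mat A)) * (N_mat A)\<^sup>T"

definition permutation_mats :: "nat \<Rightarrow> real Matrix.mat set" where
  "permutation_mats n =
     {Matrix.mat n n (\<lambda>(i, j). if i = \<sigma> j then 1 else 0) | \<sigma>. \<sigma> permutes {0..<n}}"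

text \<open>The expectation of a random matrix is taken entrywise.\<close>

definition B_RPCD :: "real Matrix.mat \<Rightarrow> real Matrix.mat" where
  "B_RPCD A =
     (let n = dim_row A
      in Matrix.mat n n (\<lambda>(i, j).
           measure_pmf.expectation (pmf_of_set (permutation_mats n))
             (\<lambda>P. (P * B_CCD A * P\<^sup>T) $$ (i, j))))"

definition B_RCD :: "real Matrix.mat \<Rightarrow> real Matrix.mat" where
  "B_RCD A = 1\<^sub>m (dim_row A) - (1 / real (dim_row A)) \<cdot>\<^sub>m A"

definition \<rho> :: "real Matrix.mat \<Rightarrow> real" where
  "\<rho> M = spectral_radius (map_mat complex_of_real M)"

definition s :: "real \<Rightarrow> nat \<Rightarrow> real" where
  "s t n = (- ln (\<rho> (B_RPCD (A_mat n t)))) / (- ln (\<rho> (B_RCD (A_mat n t)) ^ n))"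

text \<open>Meaningful only where the limit exists; \<^const>\<open>Lim\<close> is unspecified otherwise.\<close>

definition g :: "nat \<Rightarrow> real" where
  "g n = Lim (at 1 within {0<..<1}) (\<lambda>t. s t n)"

end

theory Submission
  imports Defs
begin

text \<open>
  Both averaged iteration matrices are entrywise nonnegative with constant row sums, so their
  spectral radii are these row sums (the all-ones vector is a Perron eigenvector;
  \<open>spectral_radius_const_row_sum\<close>). For \<open>B_RCD\<close> the row sum is \<open>1 - (1 - t)/n\<close>. Averaging over
  all permutations makes every row sum of \<open>B_RPCD\<close> the mean of the row sums of \<open>B_CCD\<close>, and
  forward substitution shows that row \<open>i\<close> of \<open>B_CCD\<close> sums to \<open>1 - (1 - t) w\<^sup>i\<close>, where
  \<open>w = 1 + t/(n - 1)\<close>. Hence \<open>s t n = ln p / (n ln (1 - (1 - t)/n))\<close> for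
  \<open>p = 1 - (1 - t) (1/n) \<Sum>k<n. w\<^sup>k\<close>.

  Monotonicity in \<open>t\<close> rests on the identity \<open>n p = \<Sum>j=1..n-1. (w\<^sup>n - w\<^sup>n\<^sup>-\<^sup>j)\<close>. In the
  coordinate \<open>z = ln w\<close> it says that \<open>ln p\<close> is, up to a constant,
  \<open>n z + ln (n - 1 - \<Sum>j=1..n-1. exp (-j z))\<close>, a strictly concave function of \<open>z\<close>. In the same
  coordinate the denominator of \<open>s\<close> is \<open>n (z - Z)\<close>, where \<open>Z = ln (n/(n - 1))\<close> corresponds to
  \<open>t = 1\<close>, and \<open>ln p\<close> vanishes at \<open>Z\<close>. So \<open>n * s t n\<close> is the slope of the chord of a strictly
  concave function between \<open>z\<close> and the fixed point \<open>Z\<close>, which decreases as \<open>z\<close> increases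
  (\<open>s_eq_chord_slope\<close>, \<open>chord_slope_less\<close>).

  At \<open>t = 0\<close> the number \<open>p\<close> tends to \<open>0\<close> from above while the denominator stays negative, so
  \<open>s\<close> tends to infinity. At \<open>t = 1\<close> both logarithms vanish, and the quotient of their
  derivatives is \<open>g n = (1/n) \<Sum>k<n. (n/(n - 1))\<^sup>k\<close>. With \<open>m = n - 1\<close> this is the integral of
  \<open>(1 + x/m)\<^sup>m\<close> over \<open>x\<close> from \<open>0\<close> to \<open>1\<close>; expanding by the binomial theorem gives a sum in which
  every term is nondecreasing in \<open>m\<close> and each step from \<open>m\<close> to \<open>m + 1\<close> adds a positive term, so
  \<open>g\<close> is strictly increasing. The closed form \<open>(1 + 1/m)\<^sup>m - m/(m + 1)\<close> gives the limit
  \<open>e - 1\<close>, which a strictly increasing sequence never attains.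
\<close>

section \<open>Nonnegative matrices with constant row sums\<close>

text \<open>
  The all-ones vector is an eigenvector for \<open>r\<close>; conversely, evaluating an eigenvector equation
  at a coordinate of maximal modulus bounds every eigenvalue by \<open>r\<close>.
\<close>

lemma spectral_radius_const_row_sum:
  assumes M: "M \<in> carrier_mat n n" and n: "0 < n"
    and nonneg: "\<And>i j. i < n \<Longrightarrow> j < n \<Longrightarrow> 0 \<le> M $$ (i, j)"
    and row_sum: "\<And>i. i < n \<Longrightarrow> (\<Sum>j = 0..<n. M $$ (i, j)) = r"
  shows "\<rho> M = r"
proof -
  let ?C = "map_mat complex_of_real M"
  have C: "?C \<in> carrier_mat n n" using M by auto
  have mult: "vec_index (?C *\<^sub>v v) i = (\<Sum>j = 0..<n. complex_of_real (M $$ (i, j)) * vec_index v j)"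
    if "v \<in> carrier_vec n" "i < n" for v i
    using that M by (auto simp: scalar_prod_def intro!: sum.cong)
  have r0: "0 \<le> r"
    using row_sum[OF n] nonneg[OF n] by (metis atLeastLessThan_iff sum_nonneg)
  have "eigenvector ?C (Matrix.vec n (\<lambda>_. 1)) (complex_of_real r)"
    unfolding eigenvector_def
  proof (intro conjI)
    show "Matrix.vec n (\<lambda>_. 1 :: complex) \<noteq> 0\<^sub>v (dim_row ?C)"
    proof
      assume "Matrix.vec n (\<lambda>_. 1 :: complex) = 0\<^sub>v (dim_row ?C)"
      then have "vec_index (Matrix.vec n (\<lambda>_. 1 :: complex)) 0 = vec_index (0\<^sub>v (dim_row ?C)) 0" by simp
      then show False using n M by simp
    qed
    show "?C *\<^sub>v Matrix.vec n (\<lambda>_. 1) = complex_of_real r \<cdot>\<^sub>v Matrix.vec n (\<lambda>_. 1)"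
    proof (rule eq_vecI)
      fix i assume "i < dim_vec (complex_of_real r \<cdot>\<^sub>v Matrix.vec n (\<lambda>_. 1))"
      then have i: "i < n" by simp
      then show "vec_index (?C *\<^sub>v Matrix.vec n (\<lambda>_. 1)) i
          = vec_index (complex_of_real r \<cdot>\<^sub>v Matrix.vec n (\<lambda>_. 1)) i"
        by (subst mult) (auto simp flip: row_sum)
    qed (use M in simp)
  qed (use M in auto)
  then have "complex_of_real r \<in> spectrum ?C"
    unfolding spectrum_def eigenvalue_def by auto
  then have "cmod (complex_of_real r) \<le> spectral_radius ?C"
    by (intro spectral_radius_mem_max(2)[OF C n] imageI)
  moreover have "cmod k \<le> r" if "k \<in> spectrum ?C" for k
  proof -
    from that obtain v where v: "v \<in> carrier_vec n" "v \<noteq> 0\<^sub>v n" "?C *\<^sub>v v = k \<cdot>\<^sub>v v"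
      unfolding spectrum_def eigenvalue_def eigenvector_def using M by auto
    define m where "m = Max ((\<lambda>i. cmod (vec_index v i)) ` {0..<n})"
    have le: "cmod (vec_index v i) \<le> m" if "i < n" for i
      unfolding m_def using that by (intro Max_ge) auto
    have "m \<in> (\<lambda>i. cmod (vec_index v i)) ` {0..<n}"
      unfolding m_def using n by (intro Max_in) auto
    then obtain i where i: "i < n" "m = cmod (vec_index v i)" by auto
    have "0 < m"
    proof (rule ccontr)
      assume "\<not> 0 < m"
      then have "vec_index v j = 0" if "j < n" for j
        using le[OF that] by (metis norm_le_zero_iff not_less order_trans)
      then have "v = 0\<^sub>v n" using v(1) by (intro eq_vecI) auto
      with v(2) show False by simp
    qed
    have "cmod k * m = cmod (vec_index (k \<cdot>\<^sub>v v) i)"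
      using i v(1) by (simp add: norm_mult)
    also have "\<dots> = cmod (\<Sum>j = 0..<n. complex_of_real (M $$ (i, j)) * vec_index v j)"
      using mult[OF v(1) i(1)] v(3) by simp
    also have "\<dots> \<le> (\<Sum>j = 0..<n. M $$ (i, j) * m)"
      using le nonneg i(1)
      by (intro sum_norm_le) (auto simp: norm_mult intro!: mult_left_mono)
    also have "\<dots> = r * m"
      using row_sum[OF i(1)] by (simp flip: sum_distrib_right)
    finally show ?thesis using \<open>0 < m\<close> by simp
  qed
  then have "spectral_radius ?C \<le> r"
    using spectral_radius_mem_max(1)[OF C n] by auto
  ultimately show ?thesis unfolding \<rho>_def using r0 by simp
qed

section \<open>The iteration matrix of cyclic coordinate descent\<close>

lemma N_mat_carrier: "A \<in> carrier_mat n n \<Longrightarrow> N_mat A \<in> carrier_mat n n"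
  by (auto simp: N_mat_def)

lemma N_mat_index:
  "A \<in> carrier_mat n n \<Longrightarrow> i < n \<Longrightarrow> j < n \<Longrightarrow>
     N_mat A $$ (i, j) = (if j < i then - A $$ (i, j) else 0)"
  by (auto simp: N_mat_def)

lemma sum_mult_N_mat:
  assumes A: "A \<in> carrier_mat n n" and i: "i < n"
  shows "(\<Sum>j = 0..<n. N_mat A $$ (i, j) * x j) = - (\<Sum>j<i. A $$ (i, j) * x j)"
proof -
  have "(\<Sum>j = 0..<n. N_mat A $$ (i, j) * x j) = (\<Sum>j<i. N_mat A $$ (i, j) * x j)"
    using i A by (intro sum.mono_neutral_right) (auto simp: N_mat_index)
  then show ?thesis
    using i A by (simp add: N_mat_index sum_negf)
qed

text \<open>
  A lower triangular matrix with unit diagonal has determinant 1, so the inverse in the definition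
  of \<open>B_CCD\<close> exists and \<open>B_CCD\<close> is characterised by a triangular system of equations.
\<close>

lemma B_CCD_props:
  assumes A: "A \<in> carrier_mat n n"
  shows B_CCD_carrier: "B_CCD A \<in> carrier_mat n n"
    and B_CCD_equation: "(1\<^sub>m n - N_mat A) * B_CCD A = (N_mat A)\<^sup>T"
proof -
  let ?U = "1\<^sub>m n - N_mat A"
  have U: "?U \<in> carrier_mat n n" using N_mat_carrier[OF A] by auto
  have "Determinant.det ?U = prod_list (diag_mat ?U)"
    using A by (intro det_lower_triangular[OF _ U]) (auto simp: N_mat_def)
  also have "\<dots> = 1"
    using A by (intro prod_list_neutral) (auto simp: diag_mat_def N_mat_def)
  finally have "?U \<in> Units (ring_mat TYPE(real) n ())"
    by (intro det_non_zero_imp_unit[OF U]) auto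
  then obtain L where "mat_inverse ?U = Some L"
    using mat_inverse(1)[OF U, of "()"] by (cases "mat_inverse ?U") auto
  moreover from mat_inverse(2)[OF U this] have L: "?U * L = 1\<^sub>m n" "L \<in> carrier_mat n n" by auto
  ultimately have B: "B_CCD A = L * (N_mat A)\<^sup>T"
    using A unfolding B_CCD_def by auto
  show "B_CCD A \<in> carrier_mat n n" unfolding B using L N_mat_carrier[OF A] by auto
  have "?U * B_CCD A = (?U * L) * (N_mat A)\<^sup>T"
    unfolding B using U L N_mat_carrier[OF A] by (intro assoc_mult_mat[symmetric]) auto
  then show "?U * B_CCD A = (N_mat A)\<^sup>T" using L N_mat_carrier[OF A] by simp
qed

lemma B_CCD_forward_substitution:
  assumes A: "A \<in> carrier_mat n n" and i: "i < n" and k: "k < n"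
  shows "B_CCD A $$ (i, k) = (if i < k then - A $$ (k, i) else 0) - (\<Sum>j<i. A $$ (i, j) * B_CCD A $$ (j, k))"
proof -
  have B: "B_CCD A \<in> carrier_mat n n" by (rule B_CCD_carrier[OF A])
  have "(1\<^sub>m n - N_mat A) * B_CCD A = B_CCD A - N_mat A * B_CCD A"
    using minus_mult_distrib_mat[OF one_carrier_mat N_mat_carrier[OF A] B] B by simp
  then have "(B_CCD A - N_mat A * B_CCD A) $$ (i, k) = (N_mat A)\<^sup>T $$ (i, k)"
    using B_CCD_equation[OF A] by simp
  moreover have "(B_CCD A - N_mat A * B_CCD A) $$ (i, k)
      = B_CCD A $$ (i, k) - (\<Sum>j = 0..<n. N_mat A $$ (i, j) * B_CCD A $$ (j, k))"
    using i k B N_mat_carrier[OF A] by (auto simp: scalar_prod_def)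
  moreover have "(N_mat A)\<^sup>T $$ (i, k) = (if i < k then - A $$ (k, i) else 0)"
    using i k N_mat_carrier[OF A] N_mat_index[OF A k i] by auto
  ultimately show ?thesis using sum_mult_N_mat[OF A i] by simp
qed

text \<open>
  Forward substitution computes each entry as a nonnegative number plus a combination of the
  entries above it with nonnegative coefficients.
\<close>

lemma B_CCD_nonneg:
  assumes A: "A \<in> carrier_mat n n" and i: "i < n" and k: "k < n"
    and off_diag: "\<And>i j. i < n \<Longrightarrow> j < n \<Longrightarrow> i \<noteq> j \<Longrightarrow> A $$ (i, j) \<le> 0"
  shows "0 \<le> B_CCD A $$ (i, k)"
  using i
proof (induction i rule: less_induct)
  case (less i)
  have "A $$ (i, j) * B_CCD A $$ (j, k) \<le> 0" if "j < i" for j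
    using that less off_diag[of i j] by (intro mult_nonpos_nonneg) auto
  then have "(\<Sum>j<i. A $$ (i, j) * B_CCD A $$ (j, k)) \<le> 0" by (intro sum_nonpos) auto
  then show ?case
    using B_CCD_forward_substitution[OF A less.prems k] off_diag[OF k less.prems] by auto
qed

lemma A_mat_carrier: "A_mat n t \<in> carrier_mat n n"
  by (auto simp: A_mat_def Let_def)

lemma A_mat_index:
  "i < n \<Longrightarrow> j < n \<Longrightarrow> A_mat n t $$ (i, j) = (if i = j then 1 else - (t / (real n - 1)))"
  by (auto simp: A_mat_def Let_def)

text \<open>
  Summing the forward substitution over the columns gives a linear recurrence for the row sums
  \<open>r i\<close>, namely \<open>r i = \<alpha> (n - 1 - i) + \<alpha> \<Sum>j<i. r j\<close> with \<open>\<alpha> = t/(n - 1)\<close>, whose solution is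
  the stated geometric expression.
\<close>

lemma B_CCD_A_mat_row_sum:
  assumes n: "2 \<le> n" and i: "i < n"
  shows "(\<Sum>k = 0..<n. B_CCD (A_mat n t) $$ (i, k)) = 1 - (1 - t) * (1 + t / (real n - 1)) ^ i"
  using i
proof (induction i rule: less_induct)
  case (less i)
  let ?a = "t / (real n - 1)" and ?B = "B_CCD (A_mat n t)"
  note A = A_mat_carrier[of n t]
  have na: "(real n - 1) * ?a = t" using n by simp
  have "(\<Sum>k = 0..<n. ?B $$ (i, k))
      = (\<Sum>k = 0..<n. (if i < k then ?a else 0)) + (\<Sum>k = 0..<n. \<Sum>j<i. ?a * ?B $$ (j, k))"
    unfolding sum.distrib[symmetric]
  proof (rule sum.cong[OF refl])
    fix k assume "k \<in> {0..<n}"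
    then have k: "k < n" by simp
    have "(\<Sum>j<i. A_mat n t $$ (i, j) * ?B $$ (j, k)) = (\<Sum>j<i. - (?a * ?B $$ (j, k)))"
      using less.prems by (intro sum.cong) (auto simp: A_mat_index)
    then show "?B $$ (i, k) = (if i < k then ?a else 0) + (\<Sum>j<i. ?a * ?B $$ (j, k))"
      using B_CCD_forward_substitution[OF A less.prems k] A_mat_index[OF k less.prems, of t]
      by (simp add: sum_negf)
  qed
  also have "(\<Sum>k = 0..<n. (if i < k then ?a else 0)) = (\<Sum>k = Suc i..<n. ?a)"
    by (intro sum.mono_neutral_cong_right) auto
  also have "\<dots> = (real n - 1 - real i) * ?a"
    using less.prems by (simp add: of_nat_diff)
  also have "(\<Sum>k = 0..<n. \<Sum>j<i. ?a * ?B $$ (j, k)) = ?a * (\<Sum>j<i. \<Sum>k = 0..<n. ?B $$ (j, k))"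
    by (subst sum.swap) (simp only: sum_distrib_left)
  also have "(\<Sum>j<i. \<Sum>k = 0..<n. ?B $$ (j, k)) = (\<Sum>j<i. 1 - (1 - t) * (1 + ?a) ^ j)"
    using less by (intro sum.cong) auto
  also have "\<dots> = real i - (1 - t) * (\<Sum>j<i. (1 + ?a) ^ j)"
    by (simp add: sum_subtractf sum_distrib_left)
  also have "(real n - 1 - real i) * ?a + ?a * (real i - (1 - t) * (\<Sum>j<i. (1 + ?a) ^ j))
      = (real n - 1) * ?a - (1 - t) * (?a * (\<Sum>j<i. (1 + ?a) ^ j))"
    by (simp only: algebra_simps)
  also have "\<dots> = t - (1 - t) * ((1 + ?a) ^ i - 1)"
    using power_diff_1_eq[of "1 + ?a" i] na by simp
  finally show ?case by (simp add: algebra_simps)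
qed

section \<open>Averaging over permutations\<close>

lemma permutation_conjugation_index:
  assumes \<sigma>: "\<sigma> permutes {0..<n}" and B: "B \<in> carrier_mat n n" and i: "i < n" and j: "j < n"
  defines "P \<equiv> Matrix.mat n n (\<lambda>(i, j). if i = \<sigma> j then 1 else 0 :: real)"
  shows "(P * B * P\<^sup>T) $$ (i, j) = B $$ (inv_into UNIV \<sigma> i, inv_into UNIV \<sigma> j)"
proof -
  have P: "P \<in> carrier_mat n n" by (simp add: P_def)
  have inv: "inv_into UNIV \<sigma> l < n" if "l < n" for l
    using that permutes_in_image[OF permutes_inv[OF \<sigma>]] by auto
  have iff: "l = \<sigma> k \<longleftrightarrow> k = inv_into UNIV \<sigma> l" for k l
    using permutes_inverses[OF \<sigma>] by metis
  have PB: "(P * B) $$ (i, k) = B $$ (inv_into UNIV \<sigma> i, k)" if "k < n" for k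
    using that i B inv[OF i] by (simp add: P_def scalar_prod_def iff if_distrib[of "\<lambda>x. x * _"] cong: if_cong)
  have PT: "(C * P\<^sup>T) $$ (i, j) = (\<Sum>k = 0..<n. C $$ (i, k) * P $$ (j, k))"
    if "C \<in> carrier_mat n n" for C
    using that i j P by (simp add: scalar_prod_def)
  have "(P * B * P\<^sup>T) $$ (i, j) = (\<Sum>k = 0..<n. (P * B) $$ (i, k) * P $$ (j, k))"
    by (rule PT) (rule mult_carrier_mat[OF P B])
  also have "\<dots> = (\<Sum>k = 0..<n. if k = inv_into UNIV \<sigma> j then B $$ (inv_into UNIV \<sigma> i, k) else 0)"
  proof (rule sum.cong[OF refl])
    fix k assume "k \<in> {0..<n}"
    then have k: "k < n" by simp
    have "P $$ (j, k) = (if k = inv_into UNIV \<sigma> j then 1 else 0)"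
      using j k by (simp add: P_def iff)
    then show "(P * B) $$ (i, k) * P $$ (j, k)
        = (if k = inv_into UNIV \<sigma> j then B $$ (inv_into UNIV \<sigma> i, k) else 0)"
      unfolding PB[OF k] by simp
  qed
  also have "\<dots> = B $$ (inv_into UNIV \<sigma> i, inv_into UNIV \<sigma> j)"
    using inv[OF j] by simp
  finally show ?thesis .
qed

text \<open>
  Distinct permutations give distinct matrices, so the uniform distribution on the permutation
  matrices is the uniform distribution on the permutations; replacing each permutation by its
  inverse does not change the average.
\<close>

lemma B_RPCD_index:
  assumes A: "A \<in> carrier_mat n n" and i: "i < n" and j: "j < n"
  shows "B_RPCD A $$ (i, j) = (\<Sum>\<sigma> | \<sigma> permutes {0..<n}. B_CCD A $$ (\<sigma> i, \<sigma> j)) / fact n"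
proof -
  let ?S = "{\<sigma>. \<sigma> permutes {0..<n}}"
  let ?P = "\<lambda>\<sigma>. Matrix.mat n n (\<lambda>(i, j). if i = \<sigma> j then 1 else 0 :: real)"
  have set: "permutation_mats n = ?P ` ?S" by (auto simp: permutation_mats_def)
  have inj: "inj_on ?P ?S"
  proof (rule inj_onI)
    fix \<sigma> \<tau> assume *: "\<sigma> \<in> ?S" "\<tau> \<in> ?S" "?P \<sigma> = ?P \<tau>"
    show "\<sigma> = \<tau>"
    proof
      fix k show "\<sigma> k = \<tau> k"
      proof (cases "k < n")
        case True
        then have "\<sigma> k < n" using * permutes_in_image[of \<sigma> "{0..<n}" k] by auto
        then have "?P \<sigma> $$ (\<sigma> k, k) = ?P \<tau> $$ (\<sigma> k, k)" using *(3) by simp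
        with True \<open>\<sigma> k < n\<close> show ?thesis by (simp split: if_splits)
      next
        case False then show ?thesis using * permutes_not_in[of _ "{0..<n}" k]
          by (metis atLeastLessThan_iff mem_Collect_eq)
      qed
    qed
  qed
  have fin: "finite ?S" and card: "card ?S = fact n"
    by (auto simp: finite_permutations card_permutations)
  have ne: "?S \<noteq> {}" using permutes_id by blast
  have "B_RPCD A $$ (i, j)
      = (\<Sum>P \<in> permutation_mats n. (P * B_CCD A * P\<^sup>T) $$ (i, j)) / card (permutation_mats n)"
    using A i j integral_pmf_of_set[of "permutation_mats n"] fin ne
    by (simp add: B_RPCD_def Let_def set)
  also have "\<dots> = (\<Sum>\<sigma>\<in>?S. (?P \<sigma> * B_CCD A * (?P \<sigma>)\<^sup>T) $$ (i, j)) / fact n"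
    unfolding set by (simp only: sum.reindex[OF inj] card_image[OF inj] card o_def of_nat_fact)
  also have "(\<Sum>\<sigma>\<in>?S. (?P \<sigma> * B_CCD A * (?P \<sigma>)\<^sup>T) $$ (i, j))
      = (\<Sum>\<sigma>\<in>?S. B_CCD A $$ (inv_into UNIV \<sigma> i, inv_into UNIV \<sigma> j))"
    using permutation_conjugation_index[OF _ B_CCD_carrier[OF A] i j] by (intro sum.cong) auto
  also have "\<dots> = (\<Sum>\<sigma>\<in>?S. B_CCD A $$ (\<sigma> i, \<sigma> j))"
    by (rule sum_permutations_inverse[symmetric])
  finally show ?thesis .
qed

text \<open>
  Composing with transpositions shows that the left-hand side does not depend on the point \<open>i\<close>;
  its value is then its mean over all points.
\<close>

lemma sum_permutations_at_point:
  fixes f :: "nat \<Rightarrow> real"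
  assumes i: "i < n"
  shows "(\<Sum>\<sigma> | \<sigma> permutes {0..<n}. f (\<sigma> i)) = fact n / real n * (\<Sum>k = 0..<n. f k)"
proof -
  let ?S = "{\<sigma>. \<sigma> permutes {0..<n}}"
  have eq: "(\<Sum>\<sigma>\<in>?S. f (\<sigma> j)) = (\<Sum>\<sigma>\<in>?S. f (\<sigma> i))" if "j < n" for j
  proof -
    have "Transposition.transpose i j permutes {0..<n}" using i that by (intro permutes_swap_id) auto
    from sum_permutations_compose_right[OF this, of "\<lambda>\<sigma>. f (\<sigma> i)"] show ?thesis by simp
  qed
  have "real n * (\<Sum>\<sigma>\<in>?S. f (\<sigma> i)) = (\<Sum>j = 0..<n. \<Sum>\<sigma>\<in>?S. f (\<sigma> j))"
    using eq by simp
  also have "\<dots> = (\<Sum>\<sigma>\<in>?S. \<Sum>j = 0..<n. f (\<sigma> j))" by (rule sum.swap)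
  also have "\<dots> = (\<Sum>\<sigma>\<in>?S. \<Sum>k = 0..<n. f k)"
  proof (rule sum.cong[OF refl])
    fix \<sigma> assume "\<sigma> \<in> ?S"
    then show "(\<Sum>j = 0..<n. f (\<sigma> j)) = (\<Sum>k = 0..<n. f k)"
      using sum.permute[of \<sigma> "{0..<n}" f] by (simp add: o_def)
  qed
  also have "\<dots> = fact n * (\<Sum>k = 0..<n. f k)"
    by (simp add: card_permutations)
  finally show ?thesis using i by (simp add: field_simps)
qed

lemma B_RPCD_row_sum:
  assumes A: "A \<in> carrier_mat n n" and i: "i < n"
  shows "(\<Sum>j = 0..<n. B_RPCD A $$ (i, j)) = (\<Sum>k = 0..<n. \<Sum>j = 0..<n. B_CCD A $$ (k, j)) / real n"
proof -
  let ?S = "{\<sigma>. \<sigma> permutes {0..<n}}"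
  have "(\<Sum>j = 0..<n. B_RPCD A $$ (i, j)) = (\<Sum>j = 0..<n. \<Sum>\<sigma>\<in>?S. B_CCD A $$ (\<sigma> i, \<sigma> j)) / fact n"
    unfolding sum_divide_distrib[of _ "{0..<n}"] using i by (intro sum.cong) (auto simp: B_RPCD_index[OF A])
  also have "\<dots> = (\<Sum>\<sigma>\<in>?S. \<Sum>j = 0..<n. B_CCD A $$ (\<sigma> i, \<sigma> j)) / fact n"
    by (subst sum.swap) simp
  also have "(\<Sum>\<sigma>\<in>?S. \<Sum>j = 0..<n. B_CCD A $$ (\<sigma> i, \<sigma> j))
      = (\<Sum>\<sigma>\<in>?S. \<Sum>j = 0..<n. B_CCD A $$ (\<sigma> i, j))"
  proof (rule sum.cong[OF refl])
    fix \<sigma> assume "\<sigma> \<in> ?S"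
    then show "(\<Sum>j = 0..<n. B_CCD A $$ (\<sigma> i, \<sigma> j)) = (\<Sum>j = 0..<n. B_CCD A $$ (\<sigma> i, j))"
      using sum.permute[of \<sigma> "{0..<n}" "\<lambda>j. B_CCD A $$ (\<sigma> i, j)"] by (simp add: o_def)
  qed
  also have "\<dots> = fact n / real n * (\<Sum>k = 0..<n. \<Sum>j = 0..<n. B_CCD A $$ (k, j))"
    by (rule sum_permutations_at_point[OF i])
  finally show ?thesis by simp
qed

text \<open>
  With nonnegative entries and constant row sums, the spectral radius of \<open>B_RPCD\<close> is the mean of
  the row sums of \<open>B_CCD\<close>.
\<close>

lemma \<rho>_B_RPCD_A_mat:
  assumes n: "2 \<le> n" and t: "0 \<le> t"
  shows "\<rho> (B_RPCD (A_mat n t)) = 1 - (1 - t) * ((\<Sum>k<n. (1 + t / (real n - 1)) ^ k) / real n)"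
proof -
  note A = A_mat_carrier[of n t]
  have nonneg: "0 \<le> B_CCD (A_mat n t) $$ (i, j)" if "i < n" "j < n" for i j
    using that n t by (intro B_CCD_nonneg[OF A]) (auto simp: A_mat_index)
  have "\<rho> (B_RPCD (A_mat n t)) = (\<Sum>k = 0..<n. 1 - (1 - t) * (1 + t / (real n - 1)) ^ k) / real n"
  proof (rule spectral_radius_const_row_sum)
    show "B_RPCD (A_mat n t) \<in> carrier_mat n n"
      using A by (auto simp: B_RPCD_def Let_def)
    show "0 < n" using n by simp
    fix i assume i: "i < n"
    show "(\<Sum>j = 0..<n. B_RPCD (A_mat n t) $$ (i, j))
        = (\<Sum>k = 0..<n. 1 - (1 - t) * (1 + t / (real n - 1)) ^ k) / real n"
      unfolding B_RPCD_row_sum[OF A i] using n by (simp add: B_CCD_A_mat_row_sum)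
    fix j assume j: "j < n"
    have "\<sigma> k < n" if "\<sigma> permutes {0..<n}" "k < n" for \<sigma> k
      using that permutes_in_image[of \<sigma> "{0..<n}" k] by auto
    then show "0 \<le> B_RPCD (A_mat n t) $$ (i, j)"
      unfolding B_RPCD_index[OF A i j] using i j by (auto intro!: sum_nonneg divide_nonneg_nonneg nonneg)
  qed
  also have "\<dots> = 1 - (1 - t) * ((\<Sum>k<n. (1 + t / (real n - 1)) ^ k) / real n)"
    using n by (simp add: sum_subtractf atLeast0LessThan diff_divide_distrib flip: sum_distrib_left)
  finally show ?thesis .
qed

lemma \<rho>_B_RCD_A_mat:
  assumes n: "2 \<le> n" and t: "0 \<le> t"
  shows "\<rho> (B_RCD (A_mat n t)) = 1 - (1 - t) / real n"
proof (rule spectral_radius_const_row_sum)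
  note A = A_mat_carrier[of n t]
  have idx: "B_RCD (A_mat n t) $$ (i, j) = (if i = j then 1 - 1 / real n else 0) +
      (if i = j then 0 else t / (real n * (real n - 1)))" if "i < n" "j < n" for i j
    using that A by (auto simp: B_RCD_def A_mat_index)
  show "B_RCD (A_mat n t) \<in> carrier_mat n n" using A by (auto simp: B_RCD_def)
  show "0 < n" using n by simp
  fix i assume i: "i < n"
  show "0 \<le> B_RCD (A_mat n t) $$ (i, j)" if "j < n" for j
    using that i n t by (auto simp: idx)
  have "(\<Sum>j = 0..<n. B_RCD (A_mat n t) $$ (i, j))
      = (\<Sum>j = 0..<n. (if i = j then 1 - 1 / real n - t / (real n * (real n - 1)) else 0)
           + t / (real n * (real n - 1)))"
    using i by (intro sum.cong) (auto simp: idx)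
  also have "\<dots> = 1 - 1 / real n - t / (real n * (real n - 1)) + real n * (t / (real n * (real n - 1)))"
    using i by (simp add: sum.distrib)
  also have "\<dots> = 1 - (1 - t) / real n"
  proof -
    have "real n - 1 \<noteq> 0" "real n \<noteq> 0" using n by auto
    then show ?thesis by (simp add: divide_simps) (simp add: algebra_simps)
  qed
  finally show "(\<Sum>j = 0..<n. B_RCD (A_mat n t) $$ (i, j)) = 1 - (1 - t) / real n" .
qed

section \<open>The ratio as a function of t\<close>

definition power_mean :: "nat \<Rightarrow> real \<Rightarrow> real" where
  "power_mean n t = (\<Sum>k<n. (1 + t / (real n - 1)) ^ k) / real n"

text \<open>For \<open>n \<ge> 2\<close> and \<open>t \<ge> 0\<close> this is the spectral radius of \<open>B_RPCD (A_mat n t)\<close>.\<close>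

definition rpcd_rate :: "nat \<Rightarrow> real \<Rightarrow> real" where
  "rpcd_rate n t = 1 - (1 - t) * power_mean n t"

lemma s_eq:
  assumes n: "2 \<le> n" and t: "0 \<le> t"
  shows "s t n = ln (rpcd_rate n t) / (real n * ln (1 - (1 - t) / real n))"
proof -
  have "0 < 1 - (1 - t) / real n" using n t by (simp add: field_simps)
  then show ?thesis
    using n t by (simp add: s_def \<rho>_B_RPCD_A_mat \<rho>_B_RCD_A_mat rpcd_rate_def power_mean_def ln_realpow)
qed

text \<open>
  Clearing the factor \<open>w - 1\<close> from the geometric sum turns the convergence rate into
  \<open>(1/n) \<Sum>j=1..n-1. (w\<^sup>n - w\<^sup>n\<^sup>-\<^sup>j)\<close>. This form shows that the rate is positive for \<open>w > 1\<close>, and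
  factoring out \<open>w\<^sup>n\<close> exposes its logarithmic concavity in \<open>ln w\<close>.
\<close>

lemma rpcd_rate_eq:
  assumes n: "2 \<le> n" and w: "0 < w"
  shows "rpcd_rate n ((real n - 1) * (w - 1)) = w ^ n * ((real n - 1 - (\<Sum>j = 1..<n. (1 / w) ^ j)) / real n)"
proof -
  define S where "S = (\<Sum>k<n. w ^ k)"
  have geom: "w ^ n - 1 = (w - 1) * S"
    unfolding S_def by (rule power_diff_1_eq)
  have "w ^ n * (\<Sum>j = 1..<n. (1 / w) ^ j) = (\<Sum>j = 1..<n. w ^ (n - j))"
    using w by (auto simp: sum_distrib_left power_diff power_one_over divide_inverse power_inverse intro!: sum.cong)
  also have "\<dots> = (\<Sum>k = 1..<n. w ^ k)"
    by (rule sum.reindex_bij_witness[of _ "\<lambda>k. n - k" "\<lambda>k. n - k"]) auto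
  also have "\<dots> = S - 1"
  proof -
    have "{..<n} = insert 0 {1..<n}" using n by auto
    then show ?thesis unfolding S_def by simp
  qed
  finally have sum: "w ^ n * (\<Sum>j = 1..<n. (1 / w) ^ j) = S - 1" .
  have t: "1 + (real n - 1) * (w - 1) / (real n - 1) = w" using n by simp
  have "real n * rpcd_rate n ((real n - 1) * (w - 1)) = real n - (1 - (real n - 1) * (w - 1)) * S"
    using n unfolding rpcd_rate_def power_mean_def t S_def[symmetric] by (simp add: field_simps)
  also have "\<dots> = 1 - S + (real n - 1) * (1 + (w - 1) * S)"
    by (simp add: algebra_simps)
  also have "\<dots> = (real n - 1) * w ^ n - w ^ n * (\<Sum>j = 1..<n. (1 / w) ^ j)"
    unfolding geom[symmetric] sum by simp
  finally show ?thesis using n by (simp add: field_simps)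
qed

lemma power_deficit_pos:
  assumes n: "2 \<le> n" and w: "1 < (w::real)"
  shows "0 < real n - 1 - (\<Sum>j = 1..<n. (1 / w) ^ j)"
proof -
  have "(\<Sum>j = 1..<n. (1 / w) ^ j) < (\<Sum>j = 1..<n. 1)"
    using n w by (intro sum_strict_mono) (auto simp: power_one_over)
  then show ?thesis using n by (simp add: of_nat_diff)
qed

lemma rpcd_rate_pos:
  assumes n: "2 \<le> n" and t: "0 < t"
  shows "0 < rpcd_rate n t"
proof -
  have w: "1 < 1 + t / (real n - 1)" using n t by simp
  have "rpcd_rate n t = rpcd_rate n ((real n - 1) * ((1 + t / (real n - 1)) - 1))"
    using n by simp
  then show ?thesis
    using rpcd_rate_eq[OF n, of "1 + t / (real n - 1)"] power_deficit_pos[OF n w] w n by simp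
qed

text \<open>
  The argument is \<open>z = ln w\<close> for \<open>w = 1 + t/(n - 1)\<close>, so that \<open>t = (n - 1) (exp z - 1)\<close>; it is in
  this coordinate that the logarithm of the rate is concave.
\<close>

definition log_rate :: "nat \<Rightarrow> real \<Rightarrow> real" where
  "log_rate n z = ln (rpcd_rate n ((real n - 1) * (exp z - 1)))"

lemma log_rate_eq:
  assumes n: "2 \<le> n" and z: "0 < z"
  shows "log_rate n z = real n * z + (ln (real n - 1 - (\<Sum>j = 1..<n. exp (- z) ^ j)) - ln (real n))"
proof -
  have pos: "0 < real n - 1 - (\<Sum>j = 1..<n. exp (- z) ^ j)"
    using power_deficit_pos[OF n, of "exp z"] z by (simp add: exp_minus inverse_eq_divide)
  have "log_rate n z = ln (exp z ^ n * ((real n - 1 - (\<Sum>j = 1..<n. exp (- z) ^ j)) / real n))"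
    unfolding log_rate_def rpcd_rate_eq[OF n exp_gt_zero] by (simp add: exp_minus inverse_eq_divide)
  then show ?thesis
    using pos n by (simp add: ln_mult ln_div ln_realpow)
qed

lemma log_rate_deriv:
  assumes n: "2 \<le> n" and z: "0 < z"
  shows "(log_rate n has_real_derivative
    real n + (\<Sum>j = 1..<n. real j * exp (- z) ^ j) / (real n - 1 - (\<Sum>j = 1..<n. exp (- z) ^ j))) (at z)"
proof -
  have pos: "0 < real n - 1 - (\<Sum>j = 1..<n. exp (- z) ^ j)"
    using power_deficit_pos[OF n, of "exp z"] z by (simp add: exp_minus inverse_eq_divide)
  have "((\<lambda>z. real n * z + (ln (real n - 1 - (\<Sum>j = 1..<n. exp (- z) ^ j)) - ln (real n))) has_real_derivative
    real n + (\<Sum>j = 1..<n. real j * exp (- z) ^ j) / (real n - 1 - (\<Sum>j = 1..<n. exp (- z) ^ j))) (at z)"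
  proof -
    have "((\<lambda>z. exp (- z) ^ j) has_real_derivative - (real j * exp (- z) ^ j)) (at z)" for j :: nat
      unfolding exp_of_nat_mult[symmetric] by (auto intro!: derivative_eq_intros)
    then have "((\<lambda>z. \<Sum>j = 1..<n. exp (- z) ^ j) has_real_derivative
        (\<Sum>j = 1..<n. - (real j * exp (- z) ^ j))) (at z)"
      by (intro DERIV_sum)
    moreover have "((\<lambda>z. real n * z + (ln (real n - 1 - h z) - ln (real n))) has_real_derivative
        real n + (- h') / (real n - 1 - h z)) (at z)"
      if "(h has_real_derivative h') (at z)" "0 < real n - 1 - h z" for h h'
      using that by (auto intro!: derivative_eq_intros)
    ultimately show ?thesis using pos by (fastforce simp: sum_negf)
  qed
  note deriv = this
  have "eventually (\<lambda>x. x \<in> {0<..}) (nhds z)"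
    using z by (intro eventually_nhds_in_open) auto
  then have "eventually (\<lambda>z. log_rate n z =
      real n * z + (ln (real n - 1 - (\<Sum>j = 1..<n. exp (- z) ^ j)) - ln (real n))) (nhds z)"
    by eventually_elim (simp add: log_rate_eq[OF n])
  from iffD2[OF DERIV_cong_ev[OF refl this refl] deriv] show ?thesis .
qed

text \<open>
  Strict concavity of \<open>log_rate n\<close>: in the derivative, the numerator of the fraction decreases and
  its positive denominator increases with \<open>z\<close>.
\<close>

lemma log_rate_deriv_less:
  assumes n: "2 \<le> n" and x: "0 < x" and xy: "x < y"
  shows "real n + (\<Sum>j = 1..<n. real j * exp (- y) ^ j) / (real n - 1 - (\<Sum>j = 1..<n. exp (- y) ^ j))
       < real n + (\<Sum>j = 1..<n. real j * exp (- x) ^ j) / (real n - 1 - (\<Sum>j = 1..<n. exp (- x) ^ j))"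
proof -
  have pos: "0 < real n - 1 - (\<Sum>j = 1..<n. exp (- x) ^ j)"
    using power_deficit_pos[OF n, of "exp x"] x by (simp add: exp_minus inverse_eq_divide)
  have lt: "exp (- y) ^ j < exp (- x) ^ j" if "1 \<le> j" for j :: nat
    using that xy by (intro power_strict_mono) auto
  show ?thesis
  proof (intro add_strict_left_mono frac_less)
    show "(\<Sum>j = 1..<n. real j * exp (- y) ^ j) < (\<Sum>j = 1..<n. real j * exp (- x) ^ j)"
      using n lt by (intro sum_strict_mono) auto
    show "real n - 1 - (\<Sum>j = 1..<n. exp (- x) ^ j) \<le> real n - 1 - (\<Sum>j = 1..<n. exp (- y) ^ j)"
      using less_imp_le[OF lt] by (intro diff_left_mono sum_mono) auto
  qed (use pos in \<open>auto intro!: sum_nonneg\<close>)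
qed

text \<open>
  By the mean value theorem the chord over the left interval \<open>[x, y]\<close> is steeper than the one over
  \<open>[y, z]\<close>, and the chord over \<open>[x, z]\<close> is a weighted mean of the two.
\<close>

lemma chord_slope_less:
  fixes f f' :: "real \<Rightarrow> real"
  assumes xyz: "x < y" "y < z"
    and deriv: "\<And>u. x \<le> u \<Longrightarrow> u \<le> z \<Longrightarrow> (f has_real_derivative f' u) (at u)"
    and less: "\<And>u v. x \<le> u \<Longrightarrow> u < v \<Longrightarrow> v \<le> z \<Longrightarrow> f' v < f' u"
  shows "(f z - f y) / (z - y) < (f z - f x) / (z - x)"
proof -
  obtain u where u: "x < u" "u < y" "f y - f x = (y - x) * f' u"
    using MVT2[OF xyz(1), of f f'] deriv xyz by auto
  obtain v where v: "y < v" "v < z" "f z - f y = (z - y) * f' v"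
    using MVT2[OF xyz(2), of f f'] deriv xyz by auto
  have "f' v < f' u" using u v less by auto
  then have "(y - x) * f' v < (y - x) * f' u" using xyz by simp
  then have "f' v * (z - x) < f z - f x" using u v by (simp add: algebra_simps)
  moreover have "(f z - f y) / (z - y) = f' v" using v xyz by simp
  ultimately show ?thesis using xyz by (simp add: pos_less_divide_eq)
qed

lemma rpcd_rate_0: "2 \<le> n \<Longrightarrow> rpcd_rate n 0 = 0"
  by (simp add: rpcd_rate_def power_mean_def)

lemma rpcd_rate_1: "rpcd_rate n 1 = 1"
  by (simp add: rpcd_rate_def)

text \<open>
  The rate of \<open>B_RCD\<close> is \<open>1 - (1 - t)/n = w (n - 1)/n\<close>, whose logarithm is \<open>z - Z\<close>; and
  \<open>log_rate n Z = 0\<close> because \<open>Z\<close> corresponds to \<open>t = 1\<close>, where the rate of \<open>B_RPCD\<close> is 1.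
\<close>

lemma s_eq_chord_slope:
  assumes n: "2 \<le> n" and t: "0 < t"
  defines "z \<equiv> ln (1 + t / (real n - 1))" and "Z \<equiv> ln (real n / (real n - 1))"
  shows "s t n = (log_rate n Z - log_rate n z) / (Z - z) / real n"
proof -
  have w: "0 < 1 + t / (real n - 1)" using n t by (simp add: add_pos_pos)
  have "log_rate n z = ln (rpcd_rate n t)"
    using n w unfolding log_rate_def z_def by (simp add: exp_ln)
  moreover have "(real n - 1) * (real n / (real n - 1) - 1) = 1"
    using n by (simp add: field_simps)
  then have "log_rate n Z = 0"
    using n unfolding log_rate_def Z_def by (simp add: exp_ln rpcd_rate_1)
  moreover have "z - Z = ln (1 - (1 - t) / real n)"
  proof -
    have "z - Z = ln ((1 + t / (real n - 1)) / (real n / (real n - 1)))"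
      using n w unfolding z_def Z_def by (intro ln_divide_pos[symmetric]) auto
    also have "(1 + t / (real n - 1)) / (real n / (real n - 1)) = 1 - (1 - t) / real n"
    proof -
      have "real n - 1 \<noteq> 0" "real n \<noteq> 0" using n by auto
      then show ?thesis by (simp add: divide_simps)
    qed
    finally show ?thesis .
  qed
  moreover have "- log_rate n z / (Z - z) / real n = log_rate n z / (real n * (z - Z))"
    by (metis divide_divide_eq_left minus_diff_eq minus_divide_divide mult.commute minus_minus)
  ultimately show ?thesis using s_eq[OF n] t by simp
qed

lemma s_strict_antimono:
  assumes n: "2 \<le> n"
  shows "strict_antimono_on {0<..<1} (\<lambda>t. s t n)"
proof (rule monotone_onI)
  fix t u :: real assume *: "t \<in> {0<..<1}" "u \<in> {0<..<1}" "t < u"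
  let ?z = "\<lambda>t. ln (1 + t / (real n - 1))"
  let ?Z = "ln (real n / (real n - 1))"
  have n1: "0 < real n - 1" using n by simp
  have pos: "0 < ?z t" using * n1 by (intro ln_gt_zero) auto
  have "?z t < ?z u" using * n1 by (subst ln_less_cancel_iff) (auto simp: add_pos_pos divide_strict_right_mono)
  moreover have "?z u < ?Z"
  proof -
    have "real n / (real n - 1) = 1 + 1 / (real n - 1)" using n1 by (simp add: field_simps)
    then show ?thesis
      using * n1 by (auto simp: add_pos_pos divide_strict_right_mono)
  qed
  ultimately have "(log_rate n ?Z - log_rate n (?z u)) / (?Z - ?z u)
      < (log_rate n ?Z - log_rate n (?z t)) / (?Z - ?z t)"
    using pos by (intro chord_slope_less[OF _ _ log_rate_deriv[OF n] log_rate_deriv_less[OF n]]) auto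
  moreover have "0 < t" "0 < u" using * by auto
  ultimately show "s t n > s u n"
    using n s_eq_chord_slope[OF n \<open>0 < t\<close>] s_eq_chord_slope[OF n \<open>0 < u\<close>]
    by (simp only: divide_strict_right_mono of_nat_0_less_iff)
qed

section \<open>Limits at the ends of the interval\<close>

lemma s_tendsto_at_0:
  assumes n: "2 \<le> n"
  shows "filterlim (\<lambda>t. s t n) at_top (at 0 within {0<..<1})"
proof -
  let ?F = "at (0::real) within {0<..<1}"
  have ev: "eventually (\<lambda>t::real. 0 < t) ?F" by (simp add: eventually_at_filter)
  have n1: "real n - 1 \<noteq> 0" using n by auto
  have "isCont (rpcd_rate n) 0"
    unfolding rpcd_rate_def power_mean_def using n n1 by (intro continuous_intros) auto
  then have "(rpcd_rate n \<longlongrightarrow> 0) ?F"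
    unfolding isCont_def rpcd_rate_0[OF n] by (rule tendsto_within_subset) simp
  then have "filterlim (rpcd_rate n) (at_right 0) ?F"
    using ev by (auto simp: filterlim_at elim!: eventually_mono dest: rpcd_rate_pos[OF n])
  then have "filterlim (\<lambda>t. ln (rpcd_rate n t)) at_bot ?F"
    by (rule filterlim_compose[OF ln_at_0])
  then have top: "filterlim (\<lambda>t. - ln (rpcd_rate n t)) at_top ?F"
    by (simp add: filterlim_uminus_at_top)
  have pos: "0 < 1 - (1 - (0::real)) / real n" using n by simp
  have lim: "((\<lambda>t. inverse (- (real n * ln (1 - (1 - t) / real n)))) \<longlongrightarrow>
      inverse (- (real n * ln (1 - (1 - 0) / real n)))) ?F"
    using pos n by (intro tendsto_intros) auto
  have "0 < inverse (- (real n * ln (1 - (1 - 0) / real n)))"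
    using pos n by (simp add: mult_pos_neg)
  from filterlim_tendsto_pos_mult_at_top[OF lim this top]
  have "filterlim (\<lambda>t. inverse (- (real n * ln (1 - (1 - t) / real n))) * - ln (rpcd_rate n t)) at_top ?F" .
  moreover have "eventually (\<lambda>t. s t n = inverse (- (real n * ln (1 - (1 - t) / real n))) * - ln (rpcd_rate n t)) ?F"
    using ev by eventually_elim (simp add: s_eq[OF n] divide_inverse)
  ultimately show ?thesis by (subst filterlim_cong[OF refl refl])
qed

text \<open>
  Both logarithms vanish at \<open>t = 1\<close>, so \<open>s\<close> is a quotient of difference quotients there. The
  product rule leaves \<open>power_mean n 1\<close> as the derivative of the numerator, since the factor \<open>1 - t\<close>
  kills the other term; the derivative of the denominator is 1.
\<close>

lemma s_tendsto_at_1: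
  assumes n: "2 \<le> n"
  shows "((\<lambda>t. s t n) \<longlongrightarrow> power_mean n 1) (at 1 within {0<..<1})"
proof -
  let ?N = "\<lambda>t. ln (rpcd_rate n t)" and ?D = "\<lambda>t. real n * ln (1 - (1 - t) / real n)"
  have n1: "real n - 1 \<noteq> 0" using n by auto
  have "power_mean n field_differentiable at 1"
    unfolding power_mean_def using n1 n
    by (intro derivative_intros) auto
  then obtain d where d: "(power_mean n has_real_derivative d) (at 1)"
    unfolding field_differentiable_def by auto
  have "(rpcd_rate n has_real_derivative power_mean n 1) (at 1)"
    unfolding rpcd_rate_def by (auto intro!: derivative_eq_intros d)
  then have "(?N has_real_derivative power_mean n 1) (at 1)"
    by (auto intro!: derivative_eq_intros simp: rpcd_rate_1)
  then have N: "((\<lambda>t. (?N t - ?N 1) / (t - 1)) \<longlongrightarrow> power_mean n 1) (at 1)"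
    by (simp add: has_field_derivative_iff)
  have "(?D has_real_derivative 1) (at 1)"
    using n by (auto intro!: derivative_eq_intros)
  then have "((\<lambda>t. (?D t - ?D 1) / (t - 1)) \<longlongrightarrow> 1) (at 1)"
    by (simp add: has_field_derivative_iff)
  from tendsto_divide[OF N this]
  have "((\<lambda>t. (?N t - ?N 1) / (t - 1) / ((?D t - ?D 1) / (t - 1))) \<longlongrightarrow> power_mean n 1) (at 1 within {0<..<1})"
    by (auto intro: tendsto_within_subset)
  moreover have "eventually (\<lambda>t. t \<in> {0<..<1}) (at (1::real) within {0<..<1})"
    by (simp add: eventually_at_topological) blast
  then have "eventually (\<lambda>t. (?N t - ?N 1) / (t - 1) / ((?D t - ?D 1) / (t - 1)) = s t n) (at 1 within {0<..<1})"
    by eventually_elim (auto simp: s_eq[OF n] rpcd_rate_1)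
  ultimately show ?thesis by (subst (asm) filterlim_cong[OF refl refl])
qed

section \<open>The limit as a sequence in n\<close>

lemma g_eq: "2 \<le> n \<Longrightarrow> g n = power_mean n 1"
  unfolding g_def using s_tendsto_at_1 by (intro tendsto_Lim) (auto simp: trivial_limit_within islimpt_greaterThanLessThan2)

lemma geometric_sum_one_plus_inverse:
  assumes m: "1 \<le> m"
  shows "(\<Sum>k<l. (1 + 1 / real m) ^ k) = real m * ((1 + 1 / real m) ^ l - 1)"
  using m power_diff_1_eq[of "1 + 1 / real m" l] by simp

lemma power_mean_1_closed_form:
  assumes m: "1 \<le> m"
  shows "power_mean (Suc m) 1 = (1 + 1 / real m) ^ m - real m / (real m + 1)"
proof -
  have "(\<Sum>k<Suc m. (1 + 1 / real m) ^ k) = real m * ((1 + 1 / real m) ^ Suc m - 1)"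
    by (rule geometric_sum_one_plus_inverse[OF m])
  then have "power_mean (Suc m) 1 = real m * ((1 + 1 / real m) * (1 + 1 / real m) ^ m - 1) / (real m + 1)"
    unfolding power_mean_def by (simp add: add.commute)
  also have "\<dots> = (real m * (1 + 1 / real m)) * (1 + 1 / real m) ^ m / (real m + 1) - real m / (real m + 1)"
    by (simp add: right_diff_distrib diff_divide_distrib mult.assoc)
  also have "real m * (1 + 1 / real m) = real m + 1"
    using m by (simp add: distrib_left)
  finally show ?thesis by simp
qed

text \<open>
  Both sides are the integral of \<open>(1 + x/m)\<^sup>m\<close> over \<open>x\<close> from \<open>0\<close> to \<open>1\<close>. This form, unlike the
  closed one, can be compared term by term for consecutive values of \<open>m\<close>.
\<close>

lemma power_mean_1_binomial:
  assumes m: "1 \<le> m"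
  shows "power_mean (Suc m) 1 = (\<Sum>k\<le>m. real (m choose k) / real m ^ k / (real k + 1))"
proof -
  have "(1 + 1 / real m) ^ Suc m = (\<Sum>k\<le>Suc m. real (Suc m choose k) / real m ^ k)"
    using binomial_ring[of "1 / real m" 1 "Suc m"] by (simp add: add.commute power_one_over divide_inverse power_inverse)
  also have "\<dots> = 1 + (\<Sum>k\<le>m. real (Suc m choose Suc k) / real m ^ Suc k)"
    by (subst sum.atMost_Suc_shift) (simp only: binomial_n_0 power_0 of_nat_1 div_by_1)
  also have "(\<Sum>k\<le>m. real (Suc m choose Suc k) / real m ^ Suc k)
      = (real m + 1) / real m * (\<Sum>k\<le>m. real (m choose k) / real m ^ k / (real k + 1))"
    unfolding sum_distrib_left
  proof (intro sum.cong refl)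
    fix k
    have "(real k + 1) * real (Suc m choose Suc k) = (real m + 1) * real (m choose k)"
      using Suc_times_binomial_eq[of m k] by (metis of_nat_Suc of_nat_mult mult.commute add.commute)
    then have c: "real (Suc m choose Suc k) = (real m + 1) * real (m choose k) / (real k + 1)"
      by (simp add: field_simps)
    show "real (Suc m choose Suc k) / real m ^ Suc k
        = (real m + 1) / real m * (real (m choose k) / real m ^ k / (real k + 1))"
      unfolding c by simp
  qed
  finally have *: "(1 + 1 / real m) ^ Suc m
      = 1 + (real m + 1) / real m * (\<Sum>k\<le>m. real (m choose k) / real m ^ k / (real k + 1))" .
  have "(\<Sum>k<Suc m. (1 + 1 / real m) ^ k)
      = (real m + 1) * (\<Sum>k\<le>m. real (m choose k) / real m ^ k / (real k + 1))"
    using m unfolding geometric_sum_one_plus_inverse[OF m] * by simp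
  then show ?thesis unfolding power_mean_def by (simp add: add.commute)
qed

text \<open>
  The quotient of the two sides is \<open>(1 - k/(m + 1)) / (1 - 1/(m + 1))\<^sup>k\<close>, which is at most 1 by
  Bernoulli's inequality.
\<close>

lemma binomial_over_power_mono:
  assumes m: "1 \<le> m" and k: "k \<le> m"
  shows "real (m choose k) / real m ^ k \<le> real (Suc m choose k) / real (Suc m) ^ k"
proof -
  have "1 + real k * (- 1 / real (Suc m)) \<le> (1 + - 1 / real (Suc m)) ^ k"
    by (intro Bernoulli_inequality) (simp add: field_simps)
  also have "1 + - 1 / real (Suc m) = real m / real (Suc m)" by (simp add: field_simps)
  finally have "(real (Suc m) - real k) / real (Suc m) \<le> real m ^ k / real (Suc m) ^ k"
    by (simp add: power_divide diff_divide_distrib)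
  then have "(real (Suc m choose k) / real m ^ k) * ((real (Suc m) - real k) / real (Suc m))
      \<le> (real (Suc m choose k) / real m ^ k) * (real m ^ k / real (Suc m) ^ k)"
    by (intro mult_left_mono) auto
  also have "\<dots> = real (Suc m choose k) / real (Suc m) ^ k" using m by simp
  also have "(real (Suc m choose k) / real m ^ k) * ((real (Suc m) - real k) / real (Suc m))
      = real (m choose k) / real m ^ k"
  proof -
    have "real (Suc m - k) * real (Suc m choose k) = real (Suc m) * real (m choose k)"
      using binomial_absorb_comp[of "Suc m" k] by (metis diff_Suc_1 of_nat_mult)
    then have "real (Suc m choose k) * (real (Suc m) - real k) = real (m choose k) * real (Suc m)"
      using k by (simp add: of_nat_diff mult.commute)
    moreover have "real (Suc m) \<noteq> 0" by simp
    ultimately show ?thesis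
      by (simp only: times_divide_times_eq nonzero_mult_divide_mult_cancel_right not_False_eq_True)
  qed
  finally show ?thesis .
qed

lemma g_less_Suc:
  assumes n: "2 \<le> n"
  shows "g n < g (Suc n)"
proof -
  obtain m where m: "n = Suc m" "1 \<le> m" using n by (cases n) auto
  have "power_mean (Suc m) 1 \<le> (\<Sum>k\<le>m. real (Suc m choose k) / real (Suc m) ^ k / (real k + 1))"
    unfolding power_mean_1_binomial[OF m(2)]
    using binomial_over_power_mono[OF m(2)] by (intro sum_mono divide_right_mono) auto
  also have "\<dots> < (\<Sum>k\<le>Suc m. real (Suc m choose k) / real (Suc m) ^ k / (real k + 1))"
    by (simp add: add_pos_pos)
  also have "\<dots> = power_mean (Suc (Suc m)) 1"
    by (rule power_mean_1_binomial[symmetric]) simp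
  finally show ?thesis using n by (simp add: g_eq m)
qed

lemma g_strict_mono: "strict_mono_on {2..} g"
proof (rule monotone_onI)
  have mono: "strict_mono (\<lambda>k. g (k + 2))"
    by (simp add: strict_mono_Suc_iff g_less_Suc)
  fix a b :: nat assume "a \<in> {2..}" "b \<in> {2..}" "a < b"
  then have "a - 2 < b - 2" "a - 2 + 2 = a" "b - 2 + 2 = b" by auto
  then show "g a < g b"
    using strict_monoD[OF mono, of "a - 2" "b - 2"] by metis
qed

lemma g_2: "g 2 = 3 / 2"
  by (simp add: g_eq power_mean_def numeral_2_eq_2)

lemma g_tendsto: "g \<longlonglongrightarrow> exp 1 - 1"
proof -
  have "(\<lambda>m. (1 + 1 / real m) ^ m - real m / (real m + 1)) \<longlonglongrightarrow> exp 1 - 1"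
    by (intro tendsto_diff tendsto_exp_limit_sequentially) real_asymp
  moreover have "eventually (\<lambda>m. (1 + 1 / real m) ^ m - real m / (real m + 1) = g (Suc m)) sequentially"
    using eventually_ge_at_top[of 1] by eventually_elim (simp add: g_eq power_mean_1_closed_form)
  ultimately have "(\<lambda>m. g (Suc m)) \<longlonglongrightarrow> exp 1 - 1"
    by (subst (asm) filterlim_cong[OF refl refl])
  then show ?thesis by (rule LIMSEQ_imp_Suc)
qed

lemma g_bounds:
  assumes n: "2 \<le> n"
  shows "g n \<in> {3 / 2..<exp 1 - 1}"
proof -
  have mono: "g a \<le> g b" if "2 \<le> a" "a \<le> b" for a b
    using that monotone_onD[OF g_strict_mono, of a b] by (cases "a = b") auto
  have "g n < g (Suc n)" by (rule g_less_Suc[OF n])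
  also have "g (Suc n) \<le> exp 1 - 1"
    using n by (intro LIMSEQ_le_const[OF g_tendsto] exI[of _ "Suc n"]) (auto intro: mono)
  finally show ?thesis using mono[of 2 n] n by (simp add: g_2)
qed

theorem proposition4p3:
  shows "(\<forall>n\<ge>2. strict_antimono_on {0<..<1} (\<lambda>t. s t n)) \<and>
    (\<forall>n\<ge>2. filterlim (\<lambda>t. s t n) at_top (at 0 within {0<..<1})) \<and>
    ((\<forall>n\<ge>2. ((\<lambda>t. s t n) \<longlongrightarrow> g n) (at 1 within {0<..<1})) \<and>
     (\<forall>n\<ge>2. g n \<in> {3 / 2..<exp 1 - 1}) \<and>
     strict_mono_on {2..} g \<and>
     g 2 = 3 / 2 \<and>
     g \<longlonglongrightarrow> exp 1 - 1)"
proof (intro conjI allI impI)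
  fix n :: nat assume n: "2 \<le> n"
  show "((\<lambda>t. s t n) \<longlongrightarrow> g n) (at 1 within {0<..<1})"
    unfolding g_eq[OF n] by (rule s_tendsto_at_1[OF n])
qed (fact s_strict_antimono s_tendsto_at_0 g_bounds g_strict_mono g_2 g_tendsto)+

end
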